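(* Let $\mathbb{F}$ be a totally ordered division ring. For every lattice $L$ there exist a left $\mathbb{F}$-vector space $V$ and a plenary, zero-preserving lattice embedding $\varphi\colon L\to\mathbf{Co}(V)$.
   Context: All vector spaces are left vector spaces. Let $V$ be a vector space over a totally ordered division ring $\mathbb{F}$. A subset $X\subseteq V$ is convex if $\xi_0x+\xi_1y\in X$ whenever $x,y\in X$, $\xi_0,\xi_1\geq 0$ in $\mathbb{F}$ and $\xi_0+\xi_1=1$. $\mathbf{Co}(V)$ is the lattice, under inclusion, of all convex subsets of $V$ (including $\varnothing$). $\mathrm{Co}(X)$ denotes the convex hull of $X\subseteq V$. For $\Omega\subseteq V$, $\mathbf{Co}(V,\Omega)=\{X\cap\Omega\mid X\in\mathbf{Co}(V)\}$, a lattice under inclusion; $\varphi_\Omega\colon\mathbf{Co}(V,\Omega)\to\mathbf{Co}(V)$ is the map $X\mapsto\mathrm{Co}(X)$. A subset $\Omega$ of $V$ is plenary if for every $x\in\mathrm{Co}(\Omega)$ there exists a least $X\in\mathbf{Co}(V,\Omega)$ such that $x\in\mathrm{Co}(X)$. A map $f\colon K\to K'$ between posets preserves existing meets if whenever $X\subseteq K$ has a meet in $K$, the image $f[X]$ has a meet in $K'$ and $\bigwedge f[X]=f(\bigwedge X)$. It is zero-preserving if whenever $K$ has a smallest element $0_K$, $f(0_K)$ is the smallest element of $K'$. For a join-semilattice $L$, a map $\varphi\colon L\to\mathbf{Co}(V)$ is plenary if $\varphi=\varphi_\Omega\circ\psi$ for some plenary subset $\Omega$ of $V$ and some join-homomorphism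 $\psi\colon L\to\mathbf{Co}(V,\Omega)$ that preserves existing meets. *)

theory Defs
  imports "HOL.Hull" "HOL-Algebra.Complete_Lattice" "HOL-Algebra.Module"
begin

text \<open>
  Totally ordered division rings. The classes \<^class>\<open>linordered_field\<close> and
  \<^class>\<open>linordered_idom\<close> force commutativity, which is not wanted here.
\<close>

class linordered_division_ring = division_ring + linordered_ring_strict

text \<open>
  The locale \<^locale>\<open>module\<close> of HOL-Algebra also requires commutative scalars. We keep its
  record type (whose fields \<^term>\<open>monoid.mult\<close> and \<^term>\<open>monoid.one\<close> play no role in an
  \<^locale>\<open>abelian_group\<close>), and take the scalars to be all elements of the type \<open>'f\<close>.
\<close>

locale left_vector_space = abelian_group V
  for V :: "('f::division_ring, 'v) module" (structure) +
  assumes smult_closed: "x \<in> carrier V \<Longrightarrow> \<xi> \<odot> x \<in> carrier V"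
    and smult_l_distr: "x \<in> carrier V \<Longrightarrow> (\<xi> + \<eta>) \<odot> x = (\<xi> \<odot> x) \<oplus> (\<eta> \<odot> x)"
    and smult_r_distr:
      "\<lbrakk>x \<in> carrier V; y \<in> carrier V\<rbrakk> \<Longrightarrow> \<xi> \<odot> (x \<oplus> y) = (\<xi> \<odot> x) \<oplus> (\<xi> \<odot> y)"
    and smult_assoc: "x \<in> carrier V \<Longrightarrow> (\<xi> * \<eta>) \<odot> x = \<xi> \<odot> (\<eta> \<odot> x)"
    and smult_one: "x \<in> carrier V \<Longrightarrow> 1 \<odot> x = x"

definition convex_in :: "('f::linordered_division_ring, 'v) module \<Rightarrow> 'v set \<Rightarrow> bool" where
  "convex_in V X \<longleftrightarrow> X \<subseteq> carrier V \<and>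
     (\<forall>x\<in>X. \<forall>y\<in>X. \<forall>\<xi>0 \<xi>1. 0 \<le> \<xi>0 \<and> 0 \<le> \<xi>1 \<and> \<xi>0 + \<xi>1 = 1 \<longrightarrow>
        (\<xi>0 \<odot>\<^bsub>V\<^esub> x) \<oplus>\<^bsub>V\<^esub> (\<xi>1 \<odot>\<^bsub>V\<^esub> y) \<in> X)"

text \<open>Only meaningful for subsets of \<^term>\<open>carrier V\<close>.\<close>

definition convex_hull :: "('f::linordered_division_ring, 'v) module \<Rightarrow> 'v set \<Rightarrow> 'v set" where
  "convex_hull V X = convex_in V hull X"

definition inclusion_order :: "'a set set \<Rightarrow> 'a set gorder" where
  "inclusion_order C = \<lparr>carrier = C, eq = (=), le = (\<subseteq>)\<rparr>"

definition Co :: "('f::linordered_division_ring, 'v) module \<Rightarrow> 'v set gorder" where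
  "Co V = inclusion_order {X. convex_in V X}"

definition Co_trace ::
    "('f::linordered_division_ring, 'v) module \<Rightarrow> 'v set \<Rightarrow> 'v set gorder" where
  "Co_trace V \<Omega> = inclusion_order {X \<inter> \<Omega> | X. convex_in V X}"

definition plenary_set :: "('f::linordered_division_ring, 'v) module \<Rightarrow> 'v set \<Rightarrow> bool" where
  "plenary_set V \<Omega> \<longleftrightarrow> \<Omega> \<subseteq> carrier V \<and>
     (\<forall>x \<in> convex_hull V \<Omega>. \<exists>X.
        least (Co_trace V \<Omega>) X {Y \<in> carrier (Co_trace V \<Omega>). x \<in> convex_hull V Y})"

text \<open>The empty family is included: if \<open>K\<close> has a top element, it must be sent to the top of \<open>K'\<close>.\<close>

definition preserves_existing_meets :: "'a gorder \<Rightarrow> 'b gorder \<Rightarrow> ('a \<Rightarrow> 'b) \<Rightarrow> bool" where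
  "preserves_existing_meets K K' f \<longleftrightarrow>
     (\<forall>X m. X \<subseteq> carrier K \<and> is_glb K m X \<longrightarrow> is_glb K' (f m) (f ` X))"

definition zero_preserving :: "'a gorder \<Rightarrow> 'b gorder \<Rightarrow> ('a \<Rightarrow> 'b) \<Rightarrow> bool" where
  "zero_preserving K K' f \<longleftrightarrow>
     (\<forall>z. least K z (carrier K) \<longrightarrow> least K' (f z) (carrier K'))"

text \<open>
  The constant \<^const>\<open>join_pres\<close> is not used here because it requires the domain to be a
  lattice, not just a join-semilattice.
\<close>

definition join_hom :: "'a gorder \<Rightarrow> 'b gorder \<Rightarrow> ('a \<Rightarrow> 'b) \<Rightarrow> bool" where
  "join_hom K K' f \<longleftrightarrow> f \<in> carrier K \<rightarrow> carrier K' \<and>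
     (\<forall>x \<in> carrier K. \<forall>y \<in> carrier K. f (x \<squnion>\<^bsub>K\<^esub> y) = f x \<squnion>\<^bsub>K'\<^esub> f y)"

definition lattice_embedding :: "'a gorder \<Rightarrow> 'b gorder \<Rightarrow> ('a \<Rightarrow> 'b) \<Rightarrow> bool" where
  "lattice_embedding K K' f \<longleftrightarrow> f \<in> carrier K \<rightarrow> carrier K' \<and>
     inj_on f (carrier K) \<and> join_pres K K' f \<and> meet_pres K K' f"

definition plenary_map ::
    "'l gorder \<Rightarrow> ('f::linordered_division_ring, 'v) module \<Rightarrow> ('l \<Rightarrow> 'v set) \<Rightarrow> bool" where
  "plenary_map L V \<phi> \<longleftrightarrow>
     (\<exists>\<Omega> \<psi>. plenary_set V \<Omega> \<and> join_hom L (Co_trace V \<Omega>) \<psi> \<and>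
        preserves_existing_meets L (Co_trace V \<Omega>) \<psi> \<and>
        (\<forall>a \<in> carrier L. \<phi> a = convex_hull V (\<psi> a)))"

end

theory Submission
  imports Defs
begin

text \<open>
  The space \<open>\<Omega>\<close> is grown freely so that joins of \<open>L\<close> become convex hulls. Every point carries a
  label, a non-zero element of \<open>L\<close>. The first points are linearly independent, one for each
  possible label. Whenever a point \<open>p\<close> has a label below \<open>a \<squnion> b\<close>, two further points \<open>p + e\<close> and
  \<open>p - e\<close>, with labels \<open>a\<close> and \<open>b\<close>, are added, where \<open>e\<close> is a new basis vector; call them twins and
  \<open>p\<close> their stem. Let \<open>\<psi> a\<close> be the set of all points with label below \<open>a\<close> and \<open>\<phi> a\<close> its convex
  hull. Every point with label below \<open>a \<squnion> b\<close> is the midpoint of a point of \<open>\<psi> a\<close> and a point of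
  \<open>\<psi> b\<close> (unless one of \<open>a\<close>, \<open>b\<close> is zero, when it is already in one of these sets), and therefore
  \<open>\<phi> (a \<squnion> b)\<close> is no larger than the join of \<open>\<phi> a\<close> and \<open>\<phi> b\<close>. As sets, the \<open>\<psi> a\<close> respect all
  meets that exist in \<open>L\<close>, for a label is a lower bound of a family iff it is below the meet.

  What has to be excluded is that convex hulls catch more points, or overlap more, than they
  should. A weighting of points is called normal if it never gives weight to both members of a
  pair of twins. Each element \<open>x\<close> of the hull of \<open>\<Omega>\<close> is the barycenter of exactly one normal
  weighting. It exists (\<open>weighting_normalize\<close>) because the common part of the weights of two
  twins can be moved to their stem. It is unique (\<open>normal_weighting_unique\<close>) because the
  coordinates of \<open>x\<close> along the most recently added basis vectors determine the weights of the
  most recently added points. Moving weight to stems never leaves a set \<open>X\<close> that contains the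
  stem of any two twins in it; so for such an \<open>X\<close>, the point \<open>x\<close> lies in the hull of \<open>X\<close> only if
  \<open>X\<close> contains the support of the normal weighting (\<open>normal_support_minimal\<close>).

  This has two consequences. First, the trace on \<open>\<Omega>\<close> of any convex set has that closure property,
  since it contains midpoints. Hence the trace generated by the support is the least trace whose
  hull contains \<open>x\<close>, and \<open>\<Omega>\<close> is plenary. Secondly, \<open>\<psi> a\<close> has the closure property, since the
  label of a stem is below the join of the labels of the twins. Hence \<open>\<psi> a\<close> is exactly the trace
  of \<open>\<phi> a\<close>, which gives injectivity; and if \<open>x\<close> is in \<open>\<phi> a\<close> and in \<open>\<phi> b\<close>, the least trace for \<open>x\<close>
  is included in \<open>\<psi> a \<inter> \<psi> b = \<psi> (a \<sqinter> b)\<close>, so that \<open>x\<close> is in \<open>\<phi> (a \<sqinter> b)\<close>.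
\<close>

section \<open>Ordered division rings\<close>

lemma division_ring_zero_less_one: "(0::'f::linordered_division_ring) < 1"
  using zero_le_square[of "1::'f"] by (simp add: less_le)

lemma division_ring_two_positive: "(0::'f::linordered_division_ring) < 2"
proof -
  have "(0::'f) < 1 + 1"
    by (intro add_pos_pos division_ring_zero_less_one)
  then show ?thesis by simp
qed

lemma division_ring_inverse_positive:
  fixes t :: "'f::linordered_division_ring"
  assumes "0 < t" shows "0 < inverse t"
proof (rule ccontr)
  assume "\<not> 0 < inverse t"
  then have "t * inverse t \<le> 0"
    using assms by (intro mult_nonneg_nonpos) auto
  moreover have "t * inverse t = 1"
    using assms by simp
  ultimately have "(1::'f) \<le> 0" by simp
  then show False
    using division_ring_zero_less_one[where 'f='f] by (metis not_le)
qed

section \<open>Convex hulls in spaces of functions\<close>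

definition fun_space :: "('f::ring_1, 'i \<Rightarrow> 'f) module" where
  "fun_space = \<lparr>carrier = UNIV, mult = (\<lambda>f g. f), one = (\<lambda>i. 0), zero = (\<lambda>i. 0),
     add = (\<lambda>f g i. f i + g i), smult = (\<lambda>\<xi> f i. \<xi> * f i)\<rparr>"

lemma fun_space_simps [simp]:
  "carrier fun_space = UNIV"
  "f \<oplus>\<^bsub>fun_space\<^esub> g = (\<lambda>i. f i + g i)"
  "\<xi> \<odot>\<^bsub>fun_space\<^esub> f = (\<lambda>i. \<xi> * f i)"
  "\<zero>\<^bsub>fun_space\<^esub> = (\<lambda>i. 0)"
  by (simp_all add: fun_space_def)

lemma left_vector_space_fun_space:
  "left_vector_space (fun_space :: ('f::division_ring, 'i \<Rightarrow> 'f) module)"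
proof -
  have "abelian_group (fun_space :: ('f, 'i \<Rightarrow> 'f) module)"
  proof (rule abelian_groupI)
    show "\<exists>g \<in> carrier (fun_space :: ('f, 'i \<Rightarrow> 'f) module). g \<oplus>\<^bsub>fun_space\<^esub> f = \<zero>\<^bsub>fun_space\<^esub>"
      for f :: "'i \<Rightarrow> 'f"
      by (rule bexI[of _ "\<lambda>i. - f i"]) simp_all
  qed (auto simp: algebra_simps)
  then show ?thesis
    unfolding left_vector_space_def left_vector_space_axioms_def
    by (auto simp: algebra_simps)
qed

lemma convex_in_Inter:
  "(\<And>X. X \<in> \<X> \<Longrightarrow> convex_in fun_space X) \<Longrightarrow> convex_in fun_space (\<Inter>\<X>)"
  unfolding convex_in_def by auto

lemma convex_convex_hull: "convex_in fun_space (convex_hull fun_space X)"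
  unfolding convex_hull_def by (rule hull_in) (simp add: convex_in_Inter)

lemma convex_hull_minimal:
  "X \<subseteq> Y \<Longrightarrow> convex_in V Y \<Longrightarrow> convex_hull V X \<subseteq> Y"
  unfolding convex_hull_def by (rule hull_minimal)

lemma subset_convex_hull: "X \<subseteq> convex_hull V X"
  unfolding convex_hull_def by (rule hull_subset)

lemma convex_hull_mono: "X \<subseteq> Y \<Longrightarrow> convex_hull V X \<subseteq> convex_hull V Y"
  unfolding convex_hull_def by (rule hull_mono)

definition weighting :: "'s set \<Rightarrow> ('s \<Rightarrow> 'f::linordered_division_ring) \<Rightarrow> bool" where
  "weighting X c \<longleftrightarrow> finite {s. c s \<noteq> 0} \<and> {s. c s \<noteq> 0} \<subseteq> X \<and> (\<forall>s. 0 \<le> c s) \<and>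
     (\<Sum>s | c s \<noteq> 0. c s) = 1"

text \<open>
  Weights are given to the indices of a family of vectors rather than to the vectors, since
  different indices may have the same vector.
\<close>

definition barycenter ::
    "('s \<Rightarrow> 'i \<Rightarrow> 'f::linordered_division_ring) \<Rightarrow> ('s \<Rightarrow> 'f) \<Rightarrow> 'i \<Rightarrow> 'f" where
  "barycenter v c = (\<lambda>i. \<Sum>s | c s \<noteq> 0. c s * v s i)"

lemma barycenter_superset:
  assumes "finite A" "{s. c s \<noteq> 0} \<subseteq> A"
  shows "barycenter v c i = (\<Sum>s\<in>A. c s * v s i)"
  unfolding barycenter_def by (rule sum.mono_neutral_left) (use assms in auto)

lemma weighting_superset:
  assumes "finite A" "{s. c s \<noteq> 0} \<subseteq> A"
  shows "weighting X c \<longleftrightarrow> {s. c s \<noteq> 0} \<subseteq> X \<and> (\<forall>s. 0 \<le> c s) \<and> sum c A = 1"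
proof -
  have "(\<Sum>s | c s \<noteq> 0. c s) = sum c A"
    by (rule sum.mono_neutral_left) (use assms in auto)
  then show ?thesis
    using assms finite_subset unfolding weighting_def by auto
qed

lemma weighting_dirac:
  assumes "s \<in> X"
  shows "weighting X (\<lambda>r. of_bool (r = s) :: 'f::linordered_division_ring)"
  using assms weighting_superset[of "{s}" "\<lambda>r. of_bool (r = s) :: 'f" X]
    division_ring_zero_less_one[where 'f='f] by auto

lemma barycenter_dirac:
  "barycenter v (\<lambda>r. of_bool (r = s) :: 'f::linordered_division_ring) = v s"
  using barycenter_superset[of "{s}" "\<lambda>r. of_bool (r = s) :: 'f" v] by (auto simp: fun_eq_iff)

text \<open>
  Induction on the number of points. A new point of weight less than one is combined with the
  barycenter of the others, whose weights are first rescaled to have sum one. The rescaling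
  factor is on the left because scalars need not commute.
\<close>

lemma barycenter_in_convex:
  fixes c :: "'s \<Rightarrow> 'f::linordered_division_ring"
  assumes S: "convex_in fun_space S"
    and "finite A" "\<forall>s\<in>A. v s \<in> S" "\<forall>s\<in>A. 0 \<le> c s" "sum c A = 1"
  shows "(\<lambda>i. \<Sum>s\<in>A. c s * v s i) \<in> S"
  using assms(2-)
proof (induction A arbitrary: c rule: finite_induct)
  case empty
  then show ?case by simp
next
  case (insert s A)
  let ?t = "sum c A"
  have t: "0 \<le> ?t" using insert.prems by (auto intro: sum_nonneg)
  have split: "c s + ?t = 1" using insert by simp
  show ?case
  proof (cases "?t = 0")
    case True
    then have "\<forall>r\<in>A. c r = 0"
      using insert.hyps insert.prems by (subst (asm) sum_nonneg_eq_0_iff) auto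
    then show ?thesis
      using insert split True by simp
  next
    case False
    with t have pos: "0 < ?t" by simp
    have "sum (\<lambda>r. inverse ?t * c r) A = inverse ?t * ?t"
      by (simp add: sum_distrib_left)
    also have "\<dots> = 1" using False by simp
    finally have "(\<lambda>i. \<Sum>r\<in>A. inverse ?t * c r * v r i) \<in> S"
      using insert.IH[of "\<lambda>r. inverse ?t * c r"] insert.prems
        division_ring_inverse_positive[OF pos] by (auto intro: mult_nonneg_nonneg)
    moreover have "v s \<in> S" using insert.prems by simp
    ultimately have "(\<lambda>i. c s * v s i + ?t * (\<Sum>r\<in>A. inverse ?t * c r * v r i)) \<in> S"
      using S t split insert.prems unfolding convex_in_def by (auto simp: fun_eq_iff)
    moreover have "?t * (\<Sum>r\<in>A. inverse ?t * c r * v r i) = (\<Sum>r\<in>A. c r * v r i)" for i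
    proof -
      have "?t * (inverse ?t * c r * v r i) = c r * v r i" for r
        using False by (simp add: mult.assoc[symmetric])
      then show ?thesis by (simp add: sum_distrib_left)
    qed
    ultimately show ?thesis using insert.hyps by simp
  qed
qed

lemma convex_hull_image:
  fixes v :: "'s \<Rightarrow> 'i \<Rightarrow> 'f::linordered_division_ring"
  shows "convex_hull fun_space (v ` X) = {barycenter v c | c. weighting X c}"
proof
  show "convex_hull fun_space (v ` X) \<subseteq> {barycenter v c | c. weighting X c}"
  proof (rule convex_hull_minimal)
    show "v ` X \<subseteq> {barycenter v c | c. weighting X c}"
    proof clarify
      fix s assume "s \<in> X"
      then show "\<exists>c. v s = barycenter v c \<and> weighting X c"
        using weighting_dirac[of s X] barycenter_dirac[of v s] by metis
    qed
    show "convex_in fun_space {barycenter v c | c. weighting X c}"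
      unfolding convex_in_def
    proof (intro conjI ballI allI impI)
      fix x y and \<alpha> \<beta> :: 'f
      assume "x \<in> {barycenter v c | c. weighting X c}" "y \<in> {barycenter v c | c. weighting X c}"
        and ab: "0 \<le> \<alpha> \<and> 0 \<le> \<beta> \<and> \<alpha> + \<beta> = 1"
      then obtain c d where x: "x = barycenter v c" and c: "weighting X c"
        and y: "y = barycenter v d" and d: "weighting X d" by blast
      let ?e = "\<lambda>s. \<alpha> * c s + \<beta> * d s"
      let ?A = "{s. c s \<noteq> 0} \<union> {s. d s \<noteq> 0}"
      have A: "finite ?A" "{s. c s \<noteq> 0} \<subseteq> ?A" "{s. d s \<noteq> 0} \<subseteq> ?A" "{s. ?e s \<noteq> 0} \<subseteq> ?A"
        using c d by (auto simp: weighting_def)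
      have "sum ?e ?A = \<alpha> * sum c ?A + \<beta> * sum d ?A"
        by (simp add: sum.distrib sum_distrib_left)
      also have "\<dots> = 1"
        using c d ab weighting_superset[OF A(1,2)] weighting_superset[OF A(1,3)] by auto
      finally have "weighting X ?e"
        using weighting_superset[OF A(1,4)] A c d ab
        by (auto simp: weighting_def)
      moreover have "\<alpha> \<odot>\<^bsub>fun_space\<^esub> x \<oplus>\<^bsub>fun_space\<^esub> \<beta> \<odot>\<^bsub>fun_space\<^esub> y = barycenter v ?e"
        unfolding x y fun_space_simps barycenter_superset[OF A(1,2)] barycenter_superset[OF A(1,3)]
          barycenter_superset[OF A(1,4)] fun_eq_iff
        by (simp add: sum.distrib sum_distrib_left distrib_right mult.assoc)
      ultimately show "\<alpha> \<odot>\<^bsub>fun_space\<^esub> x \<oplus>\<^bsub>fun_space\<^esub> \<beta> \<odot>\<^bsub>fun_space\<^esub> y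
          \<in> {barycenter v c | c. weighting X c}" by blast
    qed simp
  qed
  show "{barycenter v c | c. weighting X c} \<subseteq> convex_hull fun_space (v ` X)"
  proof clarify
    fix c :: "'s \<Rightarrow> 'f" assume c: "weighting X c"
    then show "barycenter v c \<in> convex_hull fun_space (v ` X)"
      unfolding barycenter_def
      using subset_convex_hull[of "v ` X" fun_space]
      by (intro barycenter_in_convex convex_convex_hull) (auto simp: weighting_def)
  qed
qed

section \<open>Twin points\<close>

text \<open>
  Points are named by words. A one-letter word names an initial point. A word
  \<open>(n, a) # (m, b) # p\<close> names one of the two twins added to the stem \<open>p\<close> for the pair \<open>{a, b}\<close>: its
  first letter has its own label \<open>a\<close> and a sign \<open>n\<close> (\<open>0\<close> for plus, \<open>1\<close> for minus), the second letter
  records the label \<open>b\<close> of the other twin (with \<open>m = 0\<close> in all words that will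
  occur). Changing the sign and exchanging the labels is therefore an involution.
\<close>

type_synonym 'a word = "(nat \<times> 'a) list"

fun twin :: "'a word \<Rightarrow> 'a word" where
  "twin ((n, a) # (m, b) # p) = (1 - n, b) # (m, a) # p"
| "twin s = s"

text \<open>
  Only signs \<open>0\<close> and \<open>1\<close> are meaningful: \<open>1 - n\<close> is truncated, so \<^const>\<open>twin\<close> is not an
  involution at a larger sign.
\<close>

definition signed :: "'a word \<Rightarrow> bool" where
  "signed s \<longleftrightarrow> s \<noteq> [] \<and> (2 \<le> length s \<longrightarrow> fst (hd s) \<le> 1)"

text \<open>
  Coordinates are indexed by words too. The new basis vector of a pair of twins is the one whose
  index is the name of the plus twin, which is why the labels are exchanged in the minus case.
\<close>

fun point :: "'a word \<Rightarrow> 'a word \<Rightarrow> 'f::ring_1" where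
  "point [] = (\<lambda>i. 0)"
| "point [x] = (\<lambda>i. of_bool (i = [x]))"
| "point ((n, a) # (m, b) # p) = (\<lambda>i. point p i +
     (if n = 0 then of_bool (i = (0, a) # (m, b) # p) else - of_bool (i = (0, b) # (m, a) # p)))"

lemma length_twin [simp]: "length (twin s) = length s"
  by (cases s rule: twin.cases) auto

lemma twin_twin: "signed s \<Longrightarrow> twin (twin s) = s"
  by (cases s rule: twin.cases) (auto simp: signed_def)

lemma signed_twin: "signed s \<Longrightarrow> signed (twin s)"
  by (cases s rule: twin.cases) (auto simp: signed_def)

lemma twin_neq: "signed s \<Longrightarrow> 2 \<le> length s \<Longrightarrow> twin s \<noteq> s"
  by (cases s rule: twin.cases) (auto simp: signed_def, presburger)

lemma twin_points_midpoint:
  assumes "signed s" "2 \<le> length s"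
  shows "point s i + point (twin s) i = 2 * point (drop 2 s) i"
proof -
  obtain n a m b p where s: "s = (n, a) # (m, b) # p"
    using assms(2) by (cases s rule: twin.cases) auto
  then have "n = 0 \<or> n = 1" using assms(1) by (auto simp: signed_def)
  then show ?thesis
    unfolding s by (elim disjE) (simp_all add: mult_2)
qed

lemma point_longer_coordinate: "length s < length i \<Longrightarrow> point s i = 0"
  by (induction s rule: point.induct) auto

text \<open>
  Along the basis vector of a pair of twins, the twins have coordinates \<open>1\<close> and \<open>-1\<close>, and all other
  points that are not longer have coordinate \<open>0\<close>, since only the twins and the points built on top
  of them involve that vector. This triangular shape makes normal weightings unique.
\<close>

lemma point_coordinate:
  assumes "signed s" "signed t" "2 \<le> length t" "fst (hd t) = 0" "length s \<le> length t"
  shows "point s t = of_bool (s = t) - of_bool (s = twin t)"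
proof (cases "length s < length t")
  case True
  then show ?thesis using assms by (auto simp: point_longer_coordinate)
next
  case False
  obtain a m b p where t: "t = (0, a) # (m, b) # p"
    using assms(3,4) by (cases t rule: twin.cases) auto
  obtain n c k d q where s: "s = (n, c) # (k, d) # q"
    using False assms(3) by (cases s rule: twin.cases) auto
  have "point q ((0, a) # (m, b) # p) = 0"
    using assms(5) s t by (intro point_longer_coordinate) simp
  moreover have "n = 0 \<or> n = 1" using assms(1) s by (auto simp: signed_def)
  ultimately show ?thesis unfolding s t by (elim disjE) auto
qed

definition normal :: "('a word \<Rightarrow> 'f::zero) \<Rightarrow> bool" where
  "normal c \<longleftrightarrow> (\<forall>s. 2 \<le> length s \<longrightarrow> c s = 0 \<or> c (twin s) = 0)"

text \<open>
  The names of the points in a convex set have this closure property, because a stem is the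
  midpoint of its twins.
\<close>

definition twin_closed :: "'a word set \<Rightarrow> bool" where
  "twin_closed X \<longleftrightarrow> (\<forall>s\<in>X. 2 \<le> length s \<and> twin s \<in> X \<longrightarrow> drop 2 s \<in> X)"

text \<open>
  Among the points at which two normal weightings differ, take one, \<open>t\<close>, of maximal length. If
  \<open>t\<close> is an initial point, both weightings differ at initial points only, and the coordinate of
  \<open>t\<close> tells them apart. Otherwise, in the
  coordinate of \<open>t\<close> and its twin all contributions to the difference cancel except those of these
  two points. So both weightings have the same difference between the weights of \<open>t\<close> and of its
  twin. By normality one of the two weights vanishes, and as weights are not negative, this
  difference determines both.
\<close>

lemma normal_weighting_unique:
  fixes c d :: "'a word \<Rightarrow> 'f::linordered_division_ring"
  assumes c: "weighting X c" "normal c" and d: "weighting X d" "normal d"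
    and X: "\<forall>s\<in>X. signed s"
    and eq: "barycenter point c = barycenter point d"
  shows "c = d"
proof (rule ccontr)
  assume "c \<noteq> d"
  let ?D = "{s. c s \<noteq> d s}"
  let ?C = "{s. c s \<noteq> 0} \<union> {s. d s \<noteq> 0}"
  have C: "finite ?C" "?C \<subseteq> X" using c d by (auto simp: weighting_def)
  have "finite ?D" by (rule finite_subset[OF _ C(1)]) auto
  moreover have "?D \<noteq> {}" using \<open>c \<noteq> d\<close> by auto
  ultimately have "Max (length ` ?D) \<in> length ` ?D" by (intro Max_in) auto
  then obtain t where t: "t \<in> ?D" and "length t = Max (length ` ?D)" by auto
  with \<open>finite ?D\<close> have max: "length s \<le> length t" if "s \<in> ?D" for s
    using that by simp
  have "t \<in> ?C" using t by auto
  then have st: "signed t" using C X by blast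
  have key: "(\<Sum>s\<in>A. (c s - d s) * point s i) = 0" if "finite A" "?C \<subseteq> A" for A i
  proof -
    have "(\<Sum>s\<in>A. (c s - d s) * point s i) = barycenter point c i - barycenter point d i"
      using that barycenter_superset[of A c point i] barycenter_superset[of A d point i]
      by (simp add: left_diff_distrib sum_subtractf)
    then show ?thesis using eq by simp
  qed
  show False
  proof (cases "2 \<le> length t")
    case False
    have "(\<Sum>s\<in>insert t ?C. (c s - d s) * point s t) = (\<Sum>s\<in>{t}. (c s - d s) * point s t)"
    proof (rule sum.mono_neutral_right)
      show "\<forall>s\<in>insert t ?C - {t}. (c s - d s) * point s t = 0"
      proof
        fix s assume s: "s \<in> insert t ?C - {t}"
        show "(c s - d s) * point s t = 0"
        proof (cases "s \<in> ?D")
          case True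
          then have "length s < 2" using max[of s] False by simp
          moreover have "signed s" using s C X by blast
          ultimately show ?thesis using s by (cases s rule: twin.cases) (auto simp: signed_def)
        qed simp
      qed
    qed (use C in auto)
    moreover have "point t t = (1::'f)"
      using False st by (cases t rule: twin.cases) (auto simp: signed_def)
    ultimately show False using key[of "insert t ?C" t] C t by auto
  next
    case True
    \<comment> \<open>The plus twin of the pair, which names the coordinate.\<close>
    define u where "u = (if fst (hd t) = 0 then t else twin t)"
    have u: "signed u" "2 \<le> length u" "fst (hd u) = 0" "length u = length t"
      "u = t \<or> twin u = t"
      using True st by (cases t rule: twin.cases; auto simp: u_def signed_def)+
    have "(\<Sum>s\<in>{u, twin u} \<union> ?C. (c s - d s) * point s u)
        = (\<Sum>s\<in>{u, twin u}. (c s - d s) * point s u)"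
    proof (rule sum.mono_neutral_right)
      show "\<forall>s\<in>{u, twin u} \<union> ?C - {u, twin u}. (c s - d s) * point s u = 0"
      proof
        fix s assume s: "s \<in> {u, twin u} \<union> ?C - {u, twin u}"
        show "(c s - d s) * point s u = 0"
        proof (cases "s \<in> ?D")
          case True
          moreover have "signed s" using s C X by blast
          ultimately show ?thesis using point_coordinate[of s u] u max[of s] s by auto
        qed simp
      qed
    qed (use C in auto)
    then have "(\<Sum>s\<in>{u, twin u}. (c s - d s) * point s u) = 0"
      using key[of "{u, twin u} \<union> ?C" u] C by auto
    moreover have pu: "point u u = (1::'f)" "point (twin u) u = (- 1::'f)"
      using u twin_neq[OF u(1,2)] point_coordinate[of u u] point_coordinate[of "twin u" u]
        signed_twin[OF u(1)] by simp_all
    have "u \<notin> {twin u}" using twin_neq[OF u(1,2)] by fastforce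
    then have "(\<Sum>s\<in>{u, twin u}. (c s - d s) * point s u) = (c u - d u) - (c (twin u) - d (twin u))"
      by (subst sum.insert) (simp_all add: pu)
    ultimately have "(c u - d u) - (c (twin u) - d (twin u)) = 0" by simp
    then have bal: "c u + d (twin u) = d u + c (twin u)" by (simp add: algebra_simps)
    have nn: "0 \<le> c s" "0 \<le> d s" for s using c d by (auto simp: weighting_def)
    have "c u = 0 \<or> c (twin u) = 0" "d u = 0 \<or> d (twin u) = 0"
      using c d u by (auto simp: normal_def)
    then have "c u = d u \<and> c (twin u) = d (twin u)"
      using bal nn[of u] nn[of "twin u"] add_nonneg_eq_0_iff
      by (metis add.right_neutral add.left_neutral)
    then show False using t u(5) by auto
  qed
qed

text \<open>
  If two twins both have positive weight, the smaller of the weights is subtracted from both and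
  added twice to their stem, which keeps the sum and the barycenter. The support loses a word
  and gains at most a shorter one, so the sum of the lengths of its words decreases.
\<close>

lemma weighting_normalize:
  fixes c :: "'a word \<Rightarrow> 'f::linordered_division_ring"
  assumes "weighting X c" "\<forall>s\<in>X. signed s" "twin_closed X"
  obtains d where "weighting X d" "normal d" "barycenter point d = barycenter point c"
proof -
  have "\<exists>d. weighting X d \<and> normal d \<and> barycenter point d = barycenter point c"
    using assms
  proof (induction "\<Sum>s | c s \<noteq> 0. length s" arbitrary: c rule: less_induct)
    case less
    note c = less.prems(1)
    show ?case
    proof (cases "normal c")
      case False
      then obtain r where r: "2 \<le> length r" "c r \<noteq> 0" "c (twin r) \<noteq> 0"
        by (auto simp: normal_def)
      have sr: "signed r" using r c less.prems(2) by (auto simp: weighting_def)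
      obtain s where s: "2 \<le> length s" "c s \<noteq> 0" "c (twin s) \<noteq> 0" "c s \<le> c (twin s)"
      proof (cases "c r \<le> c (twin r)")
        case True then show ?thesis using that r by blast
      next
        case False then show ?thesis using that[of "twin r"] r twin_twin[OF sr] by auto
      qed
      let ?p = "drop 2 s"
      let ?\<mu> = "c s"
      have s_in: "s \<in> X" "twin s \<in> X" using s c by (auto simp: weighting_def)
      have sg: "signed s" using s_in less.prems(2) by auto
      have p: "?p \<in> X" using less.prems(3) s s_in by (auto simp: twin_closed_def)
      have neq: "twin s \<noteq> s" "?p \<noteq> s" "?p \<noteq> twin s"
        using twin_neq[OF sg s(1)] s(1) length_drop[of 2 s] length_twin[of s] by force+
      \<comment> \<open>The change of weights, as a combination of three unit masses.\<close>
      define \<delta> where "\<delta> r = (if r = ?p then 2 * ?\<mu> else 0) - (if r = s then ?\<mu> else 0)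
          - (if r = twin s then ?\<mu> else 0)" for r
      let ?d = "\<lambda>r. c r + \<delta> r"
      let ?A = "insert ?p {r. c r \<noteq> 0}"
      have fin: "finite {r. c r \<noteq> 0}" and nn: "\<And>r. 0 \<le> c r"
        using c by (auto simp: weighting_def)
      have A: "finite ?A" "{r. c r \<noteq> 0} \<subseteq> ?A" "{r. ?d r \<noteq> 0} \<subseteq> ?A"
        using fin s by (auto simp: \<delta>_def split: if_splits)
      have "(0::'f) \<le> 2" using division_ring_two_positive[where 'f='f] by simp
      then have dn: "0 \<le> ?d r" for r
        using nn[of r] nn[of s] s neq by (auto simp: \<delta>_def)
      have sum\<delta>: "(\<Sum>r\<in>?A. \<delta> r * f r) = 2 * ?\<mu> * f ?p - ?\<mu> * f s - ?\<mu> * f (twin s)" for f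
      proof -
        have "\<delta> r * f r = (if r = ?p then 2 * ?\<mu> * f r else 0) - (if r = s then ?\<mu> * f r else 0)
          - (if r = twin s then ?\<mu> * f r else 0)" for r
          by (simp add: \<delta>_def left_diff_distrib)
        then show ?thesis using A(1) s by (simp add: sum_subtractf sum.delta)
      qed
      have "sum ?d ?A = sum c ?A"
        using sum\<delta>[of "\<lambda>_. 1"] by (simp only: sum.distrib) (simp add: mult_2)
      then have wd: "weighting X ?d"
        using weighting_superset[OF A(1,2)] weighting_superset[OF A(1,3)] c dn A(3) p by auto
      have bd: "barycenter point ?d = barycenter point c"
      proof
        fix i
        have "2 * ?\<mu> * point ?p i = ?\<mu> * (2 * point ?p i)"
          by (simp add: mult_2 mult_2_right distrib_left distrib_right)
        also have "\<dots> = ?\<mu> * point s i + ?\<mu> * point (twin s) i"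
          using twin_points_midpoint[OF sg s(1), of i, symmetric, where 'b='f]
          by (simp add: distrib_left)
        finally have "(\<Sum>r\<in>?A. \<delta> r * point r i) = 0" by (simp only: sum\<delta>) simp
        then show "barycenter point ?d i = barycenter point c i"
          unfolding barycenter_superset[OF A(1,2)] barycenter_superset[OF A(1,3)]
          by (simp only: distrib_right sum.distrib) simp
      qed
      have "(\<Sum>r | ?d r \<noteq> 0. length r) \<le> (\<Sum>r\<in>insert ?p ({r. c r \<noteq> 0} - {s}). length r)"
        by (rule sum_mono2) (use fin neq s(2,3) in \<open>auto simp: \<delta>_def split: if_splits\<close>)
      also have "\<dots> \<le> length ?p + (\<Sum>r\<in>{r. c r \<noteq> 0} - {s}. length r)"
        using fin by (simp add: sum.insert_if)
      also have "\<dots> < length s + (\<Sum>r\<in>{r. c r \<noteq> 0} - {s}. length r)" using s(1) by simp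
      also have "\<dots> = (\<Sum>r | c r \<noteq> 0. length r)"
        using fin s(2) by (subst (2) sum.remove[of _ s]) auto
      finally have "\<exists>e. weighting X e \<and> normal e \<and> barycenter point e = barycenter point ?d"
        using less.hyps[of ?d] wd less.prems(2,3) by blast
      then show ?thesis unfolding bd .
    qed (use c in blast)
  qed
  then show ?thesis using that by blast
qed


text \<open>
  A weighting of \<open>X\<close> can be normalized inside \<open>X\<close>; by uniqueness the result is the given normal
  weighting.
\<close>

lemma normal_support_minimal:
  fixes c :: "'a word \<Rightarrow> 'f::linordered_division_ring"
  assumes W: "\<forall>s\<in>W. signed s" and c: "weighting W c" "normal c"
    and X: "X \<subseteq> W" "twin_closed X"
    and hull: "barycenter point c \<in> convex_hull fun_space (point ` X)"
  shows "{s. c s \<noteq> 0} \<subseteq> X"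
proof -
  from hull obtain e where "weighting X e" and ce: "barycenter point c = barycenter point e"
    unfolding convex_hull_image by blast
  moreover have "\<forall>s\<in>X. signed s" using W X by blast
  ultimately obtain d where d: "weighting X d" "normal d" "barycenter point d = barycenter point e"
    using X(2) by (metis weighting_normalize)
  moreover have "weighting W d" using d(1) X(1) by (auto simp: weighting_def)
  ultimately have "c = d"
    using normal_weighting_unique[OF c _ _ W] ce by simp
  then show ?thesis using d(1) by (simp add: weighting_def)
qed

text \<open>The unit mass at a single point is normal.\<close>

lemma twin_closed_points_in_hull:
  assumes W: "\<forall>s\<in>W. signed s" and s: "s \<in> W" and X: "X \<subseteq> W" "twin_closed X"
    and hull: "(point s :: 'a word \<Rightarrow> 'f::linordered_division_ring)
      \<in> convex_hull fun_space (point ` X)"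
  shows "s \<in> X"
proof -
  let ?c = "\<lambda>r. of_bool (r = s) :: 'f"
  have "normal ?c"
    using W s twin_neq[of s] by (auto simp: normal_def)
  then have "{r. ?c r \<noteq> 0} \<subseteq> X"
    using normal_support_minimal[OF W weighting_dirac[OF s] _ X] hull by (simp add: barycenter_dirac)
  then show ?thesis by auto
qed

lemma midpoint_in_convex:
  fixes x y z :: "'i \<Rightarrow> 'f::linordered_division_ring"
  assumes "convex_in fun_space Z" "x \<in> Z" "y \<in> Z" and mid: "\<And>i. x i + y i = 2 * z i"
  shows "z \<in> Z"
proof -
  let ?h = "inverse 2 :: 'f"
  have "?h + ?h = 2 * ?h" by (simp only: mult_2)
  also have "\<dots> = 1" using division_ring_two_positive[where 'f='f] by simp
  finally have "?h + ?h = 1" .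
  moreover have "0 \<le> ?h"
    using division_ring_inverse_positive[OF division_ring_two_positive[where 'f='f]] by simp
  ultimately have "(\<lambda>i. ?h * x i + ?h * y i) \<in> Z"
    using assms(1-3) unfolding convex_in_def by auto
  moreover have "?h * x i + ?h * y i = z i" for i
  proof -
    have "?h * x i + ?h * y i = (?h * 2) * z i"
      using mid[of i] by (simp only: distrib_left[symmetric] mult.assoc)
    also have "?h * 2 = 1"
      using division_ring_two_positive[where 'f='f] by (intro left_inverse) simp
    finally show ?thesis by simp
  qed
  ultimately show ?thesis by simp
qed

definition stem_closed :: "'a word set \<Rightarrow> bool" where
  "stem_closed W \<longleftrightarrow> (\<forall>s\<in>W. 2 \<le> length s \<longrightarrow> drop 2 s \<in> W)"

lemma trace_twin_closed:
  fixes Z :: "('a word \<Rightarrow> 'f::linordered_division_ring) set"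
  assumes "\<forall>s\<in>W. signed s" "stem_closed W" "convex_in fun_space Z"
  shows "twin_closed {s \<in> W. point s \<in> Z}"
  using assms midpoint_in_convex[OF assms(3)] twin_points_midpoint
  unfolding twin_closed_def stem_closed_def by blast

section \<open>Sets ordered by inclusion\<close>

lemma inclusion_order_simps [simp]:
  "carrier (inclusion_order C) = C"
  "X \<sqsubseteq>\<^bsub>inclusion_order C\<^esub> Y \<longleftrightarrow> X \<subseteq> Y"
  by (simp_all add: inclusion_order_def)

lemma least_inclusion_order:
  "least (inclusion_order C) X A \<longleftrightarrow> A \<subseteq> C \<and> X \<in> A \<and> (\<forall>Y\<in>A. X \<subseteq> Y)"
  by (simp add: least_def)

lemma least_inclusion_order_restrict:
  "least (inclusion_order C) X {Y \<in> C. P Y} \<longleftrightarrow> X \<in> C \<and> P X \<and> (\<forall>Y\<in>C. P Y \<longrightarrow> X \<subseteq> Y)"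
  unfolding least_inclusion_order by blast

lemma is_lub_inclusion_order:
  assumes "A \<subseteq> C"
  shows "is_lub (inclusion_order C) S A \<longleftrightarrow>
     S \<in> C \<and> (\<forall>X\<in>A. X \<subseteq> S) \<and> (\<forall>Y\<in>C. (\<forall>X\<in>A. X \<subseteq> Y) \<longrightarrow> S \<subseteq> Y)"
proof -
  have "A \<inter> C = A" using assms by blast
  then have "Upper (inclusion_order C) A = {Y \<in> C. \<forall>X\<in>A. X \<subseteq> Y}"
    unfolding Upper_def inclusion_order_simps by auto
  then show ?thesis
    unfolding least_def inclusion_order_simps by (simp add: Ball_def imp_conjL)
qed

lemma is_glb_inclusion_order:
  assumes "A \<subseteq> C"
  shows "is_glb (inclusion_order C) S A \<longleftrightarrow>
     S \<in> C \<and> (\<forall>X\<in>A. S \<subseteq> X) \<and> (\<forall>Y\<in>C. (\<forall>X\<in>A. Y \<subseteq> X) \<longrightarrow> Y \<subseteq> S)"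
proof -
  have "A \<inter> C = A" using assms by blast
  then have "Lower (inclusion_order C) A = {Y \<in> C. \<forall>X\<in>A. Y \<subseteq> X}"
    unfolding Lower_def inclusion_order_simps by auto
  then show ?thesis
    unfolding greatest_def inclusion_order_simps by (simp add: Ball_def imp_conjL)
qed

lemma join_inclusion_order:
  assumes "is_lub (inclusion_order C) S {X, Y}" "X \<in> C" "Y \<in> C"
  shows "X \<squnion>\<^bsub>inclusion_order C\<^esub> Y = S"
  unfolding join_def sup_def using assms
  by (intro some_equality) (auto simp: is_lub_inclusion_order)

lemma meet_inclusion_order:
  assumes "is_glb (inclusion_order C) S {X, Y}" "X \<in> C" "Y \<in> C"
  shows "X \<sqinter>\<^bsub>inclusion_order C\<^esub> Y = S"
  unfolding meet_def inf_def using assms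
  by (intro some_equality) (auto simp: is_glb_inclusion_order)

lemma partial_order_inclusion_order: "partial_order (inclusion_order C)"
  by unfold_locales (auto simp: inclusion_order_def)

lemma is_lub_Co:
  assumes "convex_in fun_space X" "convex_in fun_space Y"
  shows "is_lub (Co fun_space) (convex_hull fun_space (X \<union> Y)) {X, Y}"
  using assms convex_convex_hull[of "X \<union> Y"] subset_convex_hull[of "X \<union> Y" fun_space]
    convex_hull_minimal[of "X \<union> Y" _ fun_space]
  by (auto simp: Co_def is_lub_inclusion_order dest: subsetD)

lemma is_glb_Co:
  assumes "convex_in fun_space X" "convex_in fun_space Y"
  shows "is_glb (Co fun_space) (X \<inter> Y) {X, Y}"
  using assms convex_in_Inter[of "{X, Y}"]
  by (auto simp: Co_def is_glb_inclusion_order)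

lemma lattice_Co: "Lattice.lattice (Co (fun_space :: ('f::linordered_division_ring, 'i \<Rightarrow> 'f) module))"
proof -
  interpret partial_order "Co (fun_space :: ('f, 'i \<Rightarrow> 'f) module)"
    unfolding Co_def by (rule partial_order_inclusion_order)
  show ?thesis
  proof
    fix X Y :: "('i \<Rightarrow> 'f) set"
    assume "X \<in> carrier (Co fun_space)" "Y \<in> carrier (Co fun_space)"
    then have "convex_in fun_space X" "convex_in fun_space Y" by (simp_all add: Co_def)
    then show "\<exists>S. is_lub (Co fun_space) S {X, Y}" "\<exists>S. is_glb (Co fun_space) S {X, Y}"
      using is_lub_Co is_glb_Co by blast+
  qed
qed

section \<open>The points form a plenary set\<close>

text \<open>
  The least trace whose hull contains \<open>x\<close> is the one generated by the support of the normal
  weighting of \<open>x\<close>: every trace is twin closed, so it contains this support as soon as its hull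
  contains \<open>x\<close>.
\<close>

lemma plenary_set_points:
  fixes W :: "'a word set"
  assumes W: "\<forall>s\<in>W. signed s" "stem_closed W"
  shows "plenary_set (fun_space :: ('f::linordered_division_ring, 'a word \<Rightarrow> 'f) module) (point ` W)"
  unfolding plenary_set_def
proof (intro conjI ballI)
  let ?V = "fun_space :: ('f, 'a word \<Rightarrow> 'f) module"
  let ?\<Omega> = "point ` W :: ('a word \<Rightarrow> 'f) set"
  fix x assume x: "x \<in> convex_hull ?V ?\<Omega>"
  have closed: "twin_closed W"
    using W(2) by (auto simp: twin_closed_def stem_closed_def)
  from x obtain e :: "'a word \<Rightarrow> 'f" where e: "weighting W e" "x = barycenter point e"
    unfolding convex_hull_image by blast
  obtain c :: "'a word \<Rightarrow> 'f" where c: "weighting W c" "normal c" "x = barycenter point c"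
    using weighting_normalize[OF e(1) W(1) closed] e(2) by metis
  let ?S = "point ` {s. c s \<noteq> 0} :: ('a word \<Rightarrow> 'f) set"
  let ?X = "convex_hull ?V ?S \<inter> ?\<Omega>"
  have "weighting {s. c s \<noteq> 0} c" using c(1) by (simp add: weighting_def)
  then have "x \<in> convex_hull ?V ?S"
    unfolding convex_hull_image c(3) by blast
  moreover have "?S \<subseteq> ?X"
    using subset_convex_hull[of ?S ?V] c(1) by (auto simp: weighting_def)
  ultimately have x_in: "x \<in> convex_hull ?V ?X"
    using convex_hull_mono by blast
  have "?X \<subseteq> Y" if "convex_in ?V Z" "Y = Z \<inter> ?\<Omega>" "x \<in> convex_hull ?V Y" for Y Z
  proof -
    have "Y = point ` {s \<in> W. point s \<in> Z}" using that(2) by blast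
    then have "{s. c s \<noteq> 0} \<subseteq> {s \<in> W. point s \<in> Z}"
      using normal_support_minimal[OF W(1) c(1,2) _ trace_twin_closed[OF W that(1)]]
        that(3) c(3) by auto
    then have "?S \<subseteq> Z" by auto
    then have "convex_hull ?V ?S \<subseteq> Z" using that(1) by (rule convex_hull_minimal)
    then show ?thesis using that(2) by blast
  qed
  then have "\<forall>Y \<in> {X \<inter> ?\<Omega> | X. convex_in ?V X}. x \<in> convex_hull ?V Y \<longrightarrow> ?X \<subseteq> Y"
    by blast
  moreover have "?X \<in> {X \<inter> ?\<Omega> | X. convex_in ?V X}"
    using convex_convex_hull by blast
  ultimately have "least (Co_trace ?V ?\<Omega>) ?X
      {Y \<in> carrier (Co_trace ?V ?\<Omega>). x \<in> convex_hull ?V Y}"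
    using x_in unfolding Co_trace_def inclusion_order_simps least_inclusion_order_restrict
    by (intro conjI)
  then show "\<exists>X. least (Co_trace ?V ?\<Omega>) X {Y \<in> carrier (Co_trace ?V ?\<Omega>). x \<in> convex_hull ?V Y}"
    by blast
qed simp

section \<open>Points labelled by a lattice\<close>

definition label :: "'l word \<Rightarrow> 'l" where
  "label s = snd (hd s)"

text \<open>
  The least element of \<open>L\<close>, if there is one, is not a label; so it is mapped to the empty set. The
  sign in the rule for twins is free because its other premises are symmetric in \<open>a\<close> and \<open>b\<close>; with
  a word, its twin is also generated.
\<close>

inductive_set words :: "('l, 'b) gorder_scheme \<Rightarrow> 'l word set"
  for L :: "('l, 'b) gorder_scheme" where
  root: "\<lbrakk>x \<in> carrier L; \<not> least L x (carrier L)\<rbrakk> \<Longrightarrow> [(0, x)] \<in> words L"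
| child: "\<lbrakk>p \<in> words L; a \<in> carrier L; b \<in> carrier L;
    \<not> least L a (carrier L); \<not> least L b (carrier L); label p \<sqsubseteq>\<^bsub>L\<^esub> a \<squnion>\<^bsub>L\<^esub> b; n \<le> 1\<rbrakk>
    \<Longrightarrow> (n, a) # (0, b) # p \<in> words L"

definition below :: "('l, 'b) gorder_scheme \<Rightarrow> 'l \<Rightarrow> 'l word set" where
  "below L a = {s \<in> words L. label s \<sqsubseteq>\<^bsub>L\<^esub> a}"

lemma below_subset_words: "below L a \<subseteq> words L"
  by (auto simp: below_def)

lemma words_signed: "\<forall>s \<in> words L. signed s"
  by (auto simp: signed_def elim: words.cases)

lemma words_stem_closed: "stem_closed (words L)"
  by (auto simp: stem_closed_def elim: words.cases)

lemma label_words: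
  "s \<in> words L \<Longrightarrow> label s \<in> carrier L \<and> \<not> least L (label s) (carrier L)"
  by (auto simp: label_def elim: words.cases)

context Lattice.lattice
begin

text \<open>The label of a stem is below the join of the labels of its twins.\<close>

lemma twin_closed_below:
  assumes "a \<in> carrier L"
  shows "twin_closed (below L a)"
  unfolding twin_closed_def
proof (intro ballI impI, elim conjE)
  fix s assume s: "s \<in> below L a" "2 \<le> length s" "twin s \<in> below L a"
  then have "s \<in> words L" by (simp add: below_def)
  then show "drop 2 s \<in> below L a"
  proof cases
    case (child p x y n)
    then have "x \<sqsubseteq> a" "y \<sqsubseteq> a" using s by (auto simp: below_def label_def)
    then have "x \<squnion> y \<sqsubseteq> a" using child assms by (simp add: join_le)
    then have "label p \<sqsubseteq> a"
      using child assms label_words[of p L] by (meson le_trans join_closed)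
    then show ?thesis using child by (simp add: below_def)
  qed (use s in simp)
qed

lemma least_join:
  assumes "least L a (carrier L)" "b \<in> carrier L"
  shows "a \<squnion> b = b"
  using assms by (intro le_antisym join_le join_right join_closed) (auto simp: least_def)

text \<open>
  This is what the twins are made for: a point with label below \<open>a \<squnion> b\<close> is the midpoint of its
  twins for \<open>a\<close> and \<open>b\<close>. There are no such twins if \<open>a\<close> or \<open>b\<close> is the least element, but then
  \<open>a \<squnion> b\<close> is the other one.
\<close>

lemma below_join_in_hull:
  assumes a: "a \<in> carrier L" and b: "b \<in> carrier L"
  shows "(point ` below L (a \<squnion> b) :: ('a word \<Rightarrow> 'f::linordered_division_ring) set)
    \<subseteq> convex_hull fun_space (point ` below L a \<union> point ` below L b)" (is "_ \<subseteq> ?H")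
proof clarify
  fix s assume "s \<in> below L (a \<squnion> b)"
  then have s: "s \<in> words L" "label s \<sqsubseteq> a \<squnion> b" by (auto simp: below_def)
  have sub: "point ` below L a \<union> point ` below L b \<subseteq> ?H" by (rule subset_convex_hull)
  consider "least L a (carrier L)" | "least L b (carrier L)"
    | "\<not> least L a (carrier L)" "\<not> least L b (carrier L)" by blast
  then show "point s \<in> ?H"
  proof cases
    case 1
    then have "s \<in> below L b" using s least_join b by (simp add: below_def)
    then show ?thesis using sub by blast
  next
    case 2
    then have "s \<in> below L a" using s least_join[of b a] a join_comm[of L a b] by (simp add: below_def)
    then show ?thesis using sub by blast
  next
    case 3
    let ?t = "(0, a) # (0, b) # s"
    have t: "?t \<in> words L" "twin ?t \<in> words L"
      using s a b 3 join_comm[of L a b] by (auto intro!: words.child)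
    then have "?t \<in> below L a" "twin ?t \<in> below L b"
      using a b by (simp_all add: below_def label_def)
    then have "point ?t \<in> ?H" "point (twin ?t) \<in> ?H"
      using sub by blast+
    moreover have "point ?t i + point (twin ?t) i = 2 * (point s i :: 'f)" for i
      using twin_points_midpoint[of ?t i] t(1) words_signed[of L] by simp
    ultimately show ?thesis
      by (rule midpoint_in_convex[OF convex_convex_hull])
  qed
qed

lemma below_least: "least L z (carrier L) \<Longrightarrow> below L z = {}"
  using label_words[of _ L]
  by (auto simp: below_def least_def intro: le_trans)

end

section \<open>The embedding\<close>

theorem theorem10p1:
  fixes L :: "'l gorder"
  assumes "Lattice.lattice L"
  shows "\<exists>(V :: ('f::linordered_division_ring, (nat \<times> 'l) list \<Rightarrow> 'f) module)
           (\<phi> :: 'l \<Rightarrow> ((nat \<times> 'l) list \<Rightarrow> 'f) set).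
           left_vector_space V \<and> lattice_embedding L (Co V) \<phi> \<and>
           plenary_map L V \<phi> \<and> zero_preserving L (Co V) \<phi>"
proof -
  interpret L: Lattice.lattice L by (rule assms)
  let ?V = "fun_space :: ('f, (nat \<times> 'l) list \<Rightarrow> 'f) module"
  let ?hull = "convex_hull ?V"
  define \<Omega> where "\<Omega> = (point ` words L :: ((nat \<times> 'l) list \<Rightarrow> 'f) set)"
  define \<psi> where "\<psi> a = (point ` below L a :: ((nat \<times> 'l) list \<Rightarrow> 'f) set)" for a
  define \<phi> where "\<phi> a = ?hull (\<psi> a)" for a
  
  have reflect: "s \<in> below L a" if "a \<in> carrier L" "s \<in> words L" "point s \<in> \<phi> a" for s a
    using that twin_closed_points_in_hull[OF words_signed that(2) below_subset_words L.twin_closed_below]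
    unfolding \<phi>_def \<psi>_def by blast
  have trace: "\<psi> a = \<phi> a \<inter> \<Omega>" if "a \<in> carrier L" for a
  proof
    show "\<psi> a \<subseteq> \<phi> a \<inter> \<Omega>"
      using subset_convex_hull[of "\<psi> a" ?V] below_subset_words[of L a]
      by (auto simp: \<phi>_def \<psi>_def \<Omega>_def)
    show "\<phi> a \<inter> \<Omega> \<subseteq> \<psi> a"
      using reflect[OF that] by (auto simp: \<psi>_def \<Omega>_def)
  qed
  have \<phi>_convex: "convex_in ?V (\<phi> a)" for a
    unfolding \<phi>_def by (rule convex_convex_hull)
  have \<psi>_mono: "\<psi> a \<subseteq> \<psi> b" if "a \<sqsubseteq>\<^bsub>L\<^esub> b" "a \<in> carrier L" "b \<in> carrier L" for a b
    using that L.le_trans label_words[of _ L] by (fastforce simp: \<psi>_def below_def)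
  have \<phi>_mono: "\<phi> a \<subseteq> \<phi> b" if "a \<sqsubseteq>\<^bsub>L\<^esub> b" "a \<in> carrier L" "b \<in> carrier L" for a b
    unfolding \<phi>_def using \<psi>_mono[OF that] by (rule convex_hull_mono)
  have \<phi>_reflects: "a \<sqsubseteq>\<^bsub>L\<^esub> b" if "\<phi> a \<subseteq> \<phi> b" "a \<in> carrier L" "b \<in> carrier L" for a b
  proof (cases "least L a (carrier L)")
    case True then show ?thesis using that by (auto simp: least_def)
  next
    case False
    then have w: "[(0, a)] \<in> words L" using that by (auto intro: words.root)
    then have "[(0, a)] \<in> below L a" using that by (simp add: below_def label_def)
    then have "point [(0, a)] \<in> \<psi> a" unfolding \<psi>_def by (rule imageI)
    then have "point [(0, a)] \<in> \<phi> b" using that trace by blast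
    then have "[(0, a)] \<in> below L b" using reflect that w by blast
    then show ?thesis by (simp add: below_def label_def)
  qed
  have carrier_trace: "carrier (Co_trace ?V \<Omega>) = {X \<inter> \<Omega> | X. convex_in ?V X}"
    by (simp add: Co_trace_def)
  have \<psi>_carrier: "\<psi> a \<in> {X \<inter> \<Omega> | X. convex_in ?V X}" if "a \<in> carrier L" for a
    using trace[OF that] \<phi>_convex by blast
  have \<psi>_join: "\<psi> (a \<squnion>\<^bsub>L\<^esub> b) \<subseteq> ?hull (\<psi> a \<union> \<psi> b)" if "a \<in> carrier L" "b \<in> carrier L" for a b
    unfolding \<psi>_def using that by (rule L.below_join_in_hull)
  have plenary: "plenary_set ?V \<Omega>"
    unfolding \<Omega>_def by (rule plenary_set_points[OF words_signed words_stem_closed])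

  have hom: "join_hom L (Co_trace ?V \<Omega>) \<psi>"
    unfolding join_hom_def
  proof (intro conjI ballI)
    show "\<psi> \<in> carrier L \<rightarrow> carrier (Co_trace ?V \<Omega>)"
      using \<psi>_carrier by (simp add: carrier_trace)
    fix a b assume ab: "a \<in> carrier L" "b \<in> carrier L"
    have "\<psi> (a \<squnion>\<^bsub>L\<^esub> b) \<subseteq> X \<inter> \<Omega>" if "convex_in ?V X" "\<psi> a \<subseteq> X \<inter> \<Omega>" "\<psi> b \<subseteq> X \<inter> \<Omega>" for X
      using \<psi>_join[OF ab] convex_hull_minimal[of "\<psi> a \<union> \<psi> b" X ?V] that trace[of "a \<squnion>\<^bsub>L\<^esub> b"]
        L.join_closed[OF ab] by blast
    then have "\<forall>Y \<in> {X \<inter> \<Omega> | X. convex_in ?V X}. \<psi> a \<subseteq> Y \<and> \<psi> b \<subseteq> Y \<longrightarrow> \<psi> (a \<squnion>\<^bsub>L\<^esub> b) \<subseteq> Y"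
      by blast
    moreover have "\<psi> a \<subseteq> \<psi> (a \<squnion>\<^bsub>L\<^esub> b)" "\<psi> b \<subseteq> \<psi> (a \<squnion>\<^bsub>L\<^esub> b)"
      using ab by (simp_all add: \<psi>_mono L.join_left L.join_right)
    ultimately have "is_lub (Co_trace ?V \<Omega>) (\<psi> (a \<squnion>\<^bsub>L\<^esub> b)) {\<psi> a, \<psi> b}"
      unfolding Co_trace_def using \<psi>_carrier[OF ab(1)] \<psi>_carrier[OF ab(2)] \<psi>_carrier[OF L.join_closed[OF ab]]
      by (subst is_lub_inclusion_order) (simp_all only: insert_subset empty_subsetI ball_simps simp_thms)
    then show "\<psi> (a \<squnion>\<^bsub>L\<^esub> b) = \<psi> a \<squnion>\<^bsub>Co_trace ?V \<Omega>\<^esub> \<psi> b"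
      unfolding Co_trace_def
      using ab \<psi>_carrier by (intro join_inclusion_order[symmetric]) auto
  qed

  have meets: "preserves_existing_meets L (Co_trace ?V \<Omega>) \<psi>"
    unfolding preserves_existing_meets_def
  proof (intro allI impI, elim conjE)
    fix X m assume X: "X \<subseteq> carrier L" and m: "is_glb L m X"
    then have mc: "m \<in> carrier L" and mX: "\<And>x. x \<in> X \<Longrightarrow> m \<sqsubseteq>\<^bsub>L\<^esub> x"
      and glb: "\<And>l. l \<in> carrier L \<Longrightarrow> (\<And>x. x \<in> X \<Longrightarrow> l \<sqsubseteq>\<^bsub>L\<^esub> x) \<Longrightarrow> l \<sqsubseteq>\<^bsub>L\<^esub> m"
      by (auto simp: greatest_def Lower_def)
    have "Y \<subseteq> \<psi> m" if Y\<Omega>: "Y \<subseteq> \<Omega>" and YX: "\<And>x. x \<in> X \<Longrightarrow> Y \<subseteq> \<psi> x" for Y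
    proof
      fix y assume y: "y \<in> Y"
      then obtain s where s: "s \<in> words L" "y = point s" using Y\<Omega> by (auto simp: \<Omega>_def)
      have "label s \<sqsubseteq>\<^bsub>L\<^esub> x" if "x \<in> X" for x
      proof -
        have "x \<in> carrier L" "point s \<in> \<phi> x"
          using trace[of x] X s y that YX[OF that] by blast+
        then show ?thesis using reflect s(1) by (simp add: below_def)
      qed
      then have "label s \<sqsubseteq>\<^bsub>L\<^esub> m" using glb label_words[OF s(1)] by blast
      then show "y \<in> \<psi> m" using s by (simp add: \<psi>_def below_def)
    qed
    then have "\<forall>Y \<in> {X \<inter> \<Omega> | X. convex_in ?V X}. (\<forall>x\<in>X. Y \<subseteq> \<psi> x) \<longrightarrow> Y \<subseteq> \<psi> m"
      by blast
    moreover have "\<forall>x\<in>X. \<psi> m \<subseteq> \<psi> x"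
      using \<psi>_mono[OF mX mc] X by blast
    moreover have "\<psi> ` X \<subseteq> {X \<inter> \<Omega> | X. convex_in ?V X}" using \<psi>_carrier X by blast
    ultimately show "is_glb (Co_trace ?V \<Omega>) (\<psi> m) (\<psi> ` X)"
      unfolding Co_trace_def using \<psi>_carrier[OF mc]
      by (simp only: is_glb_inclusion_order ball_simps simp_thms)
  qed

  have "plenary_map L ?V \<phi>"
    unfolding plenary_map_def using plenary hom meets by (auto simp: \<phi>_def)
  moreover have "zero_preserving L (Co ?V) \<phi>"
    unfolding zero_preserving_def
  proof (intro allI impI)
    fix z assume "least L z (carrier L)"
    then have "\<phi> z = ?hull {}" by (simp add: \<phi>_def \<psi>_def L.below_least)
    also have "\<dots> = {}"
      using convex_hull_minimal[of "{}" "{}" ?V] by (simp add: convex_in_def)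
    finally show "least (Co ?V) (\<phi> z) (carrier (Co ?V))"
      by (simp add: Co_def least_inclusion_order convex_in_def)
  qed
  moreover have "lattice_embedding L (Co ?V) \<phi>"
    unfolding lattice_embedding_def
  proof (intro conjI)
    show "\<phi> \<in> carrier L \<rightarrow> carrier (Co ?V)" using \<phi>_convex by (simp add: Co_def)
    show "inj_on \<phi> (carrier L)"
      by (intro inj_onI L.le_antisym \<phi>_reflects) auto
    show "join_pres L (Co ?V) \<phi>"
      unfolding join_pres_def
    proof (intro conjI ballI)
      fix a b assume ab: "a \<in> carrier L" "b \<in> carrier L"
      have "\<phi> (a \<squnion>\<^bsub>L\<^esub> b) = ?hull (\<phi> a \<union> \<phi> b)"
      proof
        have "\<psi> a \<union> \<psi> b \<subseteq> \<phi> a \<union> \<phi> b" using trace ab by blast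
        then have "\<psi> (a \<squnion>\<^bsub>L\<^esub> b) \<subseteq> ?hull (\<phi> a \<union> \<phi> b)"
          using \<psi>_join[OF ab] convex_hull_mono by blast
        then show "\<phi> (a \<squnion>\<^bsub>L\<^esub> b) \<subseteq> ?hull (\<phi> a \<union> \<phi> b)"
          unfolding \<phi>_def[of "a \<squnion>\<^bsub>L\<^esub> b"] by (rule convex_hull_minimal[OF _ convex_convex_hull])
        show "?hull (\<phi> a \<union> \<phi> b) \<subseteq> \<phi> (a \<squnion>\<^bsub>L\<^esub> b)"
          using ab \<phi>_mono[OF L.join_left] \<phi>_mono[OF L.join_right]
          by (intro convex_hull_minimal \<phi>_convex) auto
      qed
      then show "\<phi> (a \<squnion>\<^bsub>L\<^esub> b) = \<phi> a \<squnion>\<^bsub>Co ?V\<^esub> \<phi> b"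
        using is_lub_Co[OF \<phi>_convex \<phi>_convex, of a b] \<phi>_convex
        unfolding Co_def by (intro join_inclusion_order[symmetric]) auto
    qed (simp_all add: assms lattice_Co)
    show "meet_pres L (Co ?V) \<phi>"
      unfolding meet_pres_def
    proof (intro conjI ballI)
      fix a b assume ab: "a \<in> carrier L" "b \<in> carrier L"
      have "\<phi> (a \<sqinter>\<^bsub>L\<^esub> b) = \<phi> a \<inter> \<phi> b"
      proof
        show "\<phi> (a \<sqinter>\<^bsub>L\<^esub> b) \<subseteq> \<phi> a \<inter> \<phi> b"
          using ab \<phi>_mono[OF L.meet_left] \<phi>_mono[OF L.meet_right] by auto
        show "\<phi> a \<inter> \<phi> b \<subseteq> \<phi> (a \<sqinter>\<^bsub>L\<^esub> b)"
        proof
          fix x assume x: "x \<in> \<phi> a \<inter> \<phi> b"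
          have "\<psi> a \<subseteq> \<Omega>" using trace[OF ab(1)] by blast
          then have "\<phi> a \<subseteq> ?hull \<Omega>" unfolding \<phi>_def by (rule convex_hull_mono)
          then have "x \<in> ?hull \<Omega>" using x by blast
          then obtain X where "least (Co_trace ?V \<Omega>) X
              {Y \<in> carrier (Co_trace ?V \<Omega>). x \<in> ?hull Y}"
            using plenary unfolding plenary_set_def by blast
          then have X: "X \<subseteq> \<Omega>" "x \<in> ?hull X"
            and least: "\<And>Y. Y \<in> {X \<inter> \<Omega> | X. convex_in ?V X} \<Longrightarrow> x \<in> ?hull Y \<Longrightarrow> X \<subseteq> Y"
            unfolding Co_trace_def least_inclusion_order by auto
          have "X \<subseteq> \<psi> a" "X \<subseteq> \<psi> b"
            using least[OF \<psi>_carrier] ab x by (auto simp: \<phi>_def)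
          have "X \<subseteq> \<psi> (a \<sqinter>\<^bsub>L\<^esub> b)"
          proof
            fix y assume y: "y \<in> X"
            then obtain s where s: "s \<in> words L" "y = point s" using X(1) by (auto simp: \<Omega>_def)
            then have "s \<in> below L a" "s \<in> below L b"
              using y \<open>X \<subseteq> \<psi> a\<close> \<open>X \<subseteq> \<psi> b\<close> trace ab reflect by blast+
            then have "s \<in> below L (a \<sqinter>\<^bsub>L\<^esub> b)"
              using ab label_words[OF s(1)] L.meet_le by (simp add: below_def)
            then show "y \<in> \<psi> (a \<sqinter>\<^bsub>L\<^esub> b)" using s by (simp add: \<psi>_def)
          qed
          then show "x \<in> \<phi> (a \<sqinter>\<^bsub>L\<^esub> b)"
            unfolding \<phi>_def using X(2) convex_hull_mono by blast
        qed
      qed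
      then show "\<phi> (a \<sqinter>\<^bsub>L\<^esub> b) = \<phi> a \<sqinter>\<^bsub>Co ?V\<^esub> \<phi> b"
        using is_glb_Co[OF \<phi>_convex \<phi>_convex, of a b] \<phi>_convex
        unfolding Co_def by (intro meet_inclusion_order[symmetric]) auto
    qed (simp_all add: assms lattice_Co)
  qed
  ultimately show ?thesis using left_vector_space_fun_space by blast
qed

end
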